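(* Let $\lambda,\alpha,\beta,T,L,v>0$, $\tau^{\mathrm{down}},\tau^{\mathrm{up}}\ge 0$, let $H$ be a positive integer, $k\ge 0$ an integer, and $T_0=L/v$. In the arrival/upload model described in the context, let $M^{\mathrm{suc}}_k$ be the number of vehicles that successfully upload their models in round $k$. Put $$\mathcal{T}_{\min}(H)=\alpha H+\tau^{\mathrm{down}}+\tau^{\mathrm{up}},\qquad \Xi(H,T)=\min\{T,T_0\}-\mathcal{T}_{\min}(H).$$ If $\Xi(H,T)>0$, then $M^{\mathrm{suc}}_k$ follows a Poisson distribution with parameter $$\Lambda(H,T)=2\lambda\,\Xi(H,T)+\lambda\left(1-e^{-\frac{\Xi(H,T)}{\beta H}}\right)\bigl(|T-T_0|-2\beta H\bigr).$$
   Context: Model. Vehicles drive at constant speed $v$ through a road section of length $L$, so each vehicle stays in the section for a time $T_0=L/v$. The arrival times $\zeta^A_m$ of the vehicles $m$ at the section form a homogeneous Poisson process on the real line with rate $\lambda$. Time is divided into rounds of duration $T$, round $k$ being the time interval from $kT$ to $(k+1)T$. The set $\mathcal{M}_k$ of vehicles appearing during round $k$ consists of the vehicles with $\zeta^A_m\in(kT-T_0,(k+1)T)$. In round $k$, each vehicle $m\in\mathcal{M}_k$ has a random computing delay $\tau^{\mathrm{cp}}_{k,m}$ with the shifted exponential distribution $$\mathbb{P}\{\tau^{\mathrm{cp}}_{k,m}\le t\}=\begin{cases}1-e^{-\frac{1}{\beta H}(t-\alpha H)}, & t\ge\alpha H,\\ 0,&\text{otherwise.}\end{cases}$$ The computing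 delays of different vehicles are mutually independent and independent of the arrival process. The download and upload delays are the constants $\tau^{\mathrm{down}}$ and $\tau^{\mathrm{up}}$. Define the upload completion time and the upload deadline by $$\Phi^{[1]}_{k,m}=\max\{kT,\zeta^A_m\}+\tau^{\mathrm{down}}+\tau^{\mathrm{cp}}_{k,m}+\tau^{\mathrm{up}},\qquad \Phi^{[2]}_{k,m}=\min\{\zeta^A_m+T_0,(k+1)T\}.$$ Vehicle $m\in\mathcal{M}_k$ successfully uploads in round $k$ if and only if $\Phi^{[1]}_{k,m}\le\Phi^{[2]}_{k,m}$, and $M^{\mathrm{suc}}_k$ is the number of such vehicles. *)

theory Defs
  imports "HOL-Probability.Probability"
begin

text \<open>
  A point process on the real line is given by its labelled points: \<open>Z m \<omega>\<close> is the position of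
  the point with label \<open>m\<close>. No particular labelling (such as an increasing enumeration) is
  required, and points are counted by label, hence with multiplicity. Local finiteness has to be
  stated separately because \<open>card\<close> is \<open>0\<close> on infinite sets.
\<close>

definition point_count :: "('v \<Rightarrow> 'w \<Rightarrow> real) \<Rightarrow> real set \<Rightarrow> 'w \<Rightarrow> nat" where
  "point_count Z B \<omega> = card {m. Z m \<omega> \<in> B}"

definition (in prob_space) homogeneous_poisson_process ::
    "real \<Rightarrow> ('v \<Rightarrow> 'a \<Rightarrow> real) \<Rightarrow> bool" where
  "homogeneous_poisson_process rate Z \<longleftrightarrow>
     (\<forall>m. random_variable borel (Z m)) \<and>
     (AE \<omega> in M. \<forall>a b. finite {m. Z m \<omega> \<in> {a..b}}) \<and>
     (\<forall>a b. a < b \<longrightarrow>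
        distr M (count_space UNIV) (point_count Z {a<..b}) =
          measure_pmf (poisson_pmf (rate * (b - a)))) \<and>
     (\<forall>t :: nat \<Rightarrow> real. mono t \<longrightarrow>
        indep_vars (\<lambda>_. count_space UNIV) (\<lambda>i. point_count Z {t i<..t (Suc i)}) UNIV)"

text \<open>
  Below, \<open>z\<close> and \<open>c\<close> are the realized arrival times and round-\<open>k\<close> computing delays, as functions
  of the vehicle. Delays of vehicles outside \<open>round_vehicles\<close> are never used.
\<close>

definition round_vehicles :: "real \<Rightarrow> real \<Rightarrow> nat \<Rightarrow> ('v \<Rightarrow> real) \<Rightarrow> 'v set" where
  "round_vehicles T T0 k z = {m. z m \<in> {real k * T - T0<..<(real k + 1) * T}}"

definition upload_completion :: "real \<Rightarrow> real \<Rightarrow> real \<Rightarrow> nat \<Rightarrow> real \<Rightarrow> real \<Rightarrow> real" where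
  "upload_completion T \<tau>\<^sub>d\<^sub>o\<^sub>w\<^sub>n \<tau>\<^sub>u\<^sub>p k arrival delay =
     max (real k * T) arrival + \<tau>\<^sub>d\<^sub>o\<^sub>w\<^sub>n + delay + \<tau>\<^sub>u\<^sub>p"

definition upload_deadline :: "real \<Rightarrow> real \<Rightarrow> nat \<Rightarrow> real \<Rightarrow> real" where
  "upload_deadline T T0 k arrival = min (arrival + T0) ((real k + 1) * T)"

definition successful_vehicles ::
    "real \<Rightarrow> real \<Rightarrow> real \<Rightarrow> real \<Rightarrow> nat \<Rightarrow> ('v \<Rightarrow> real) \<Rightarrow> ('v \<Rightarrow> real) \<Rightarrow> 'v set" where
  "successful_vehicles T T0 \<tau>\<^sub>d\<^sub>o\<^sub>w\<^sub>n \<tau>\<^sub>u\<^sub>p k z c =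
     {m \<in> round_vehicles T T0 k z.
        upload_completion T \<tau>\<^sub>d\<^sub>o\<^sub>w\<^sub>n \<tau>\<^sub>u\<^sub>p k (z m) (c m) \<le> upload_deadline T T0 k (z m)}"

definition M_suc ::
    "real \<Rightarrow> real \<Rightarrow> real \<Rightarrow> real \<Rightarrow> ('v \<Rightarrow> 'w \<Rightarrow> real) \<Rightarrow> (nat \<Rightarrow> 'v \<Rightarrow> 'w \<Rightarrow> real) \<Rightarrow> nat \<Rightarrow> 'w \<Rightarrow> nat" where
  "M_suc T T0 \<tau>\<^sub>d\<^sub>o\<^sub>w\<^sub>n \<tau>\<^sub>u\<^sub>p \<zeta> \<tau>\<^sub>c\<^sub>p k \<omega> =
     card (successful_vehicles T T0 \<tau>\<^sub>d\<^sub>o\<^sub>w\<^sub>n \<tau>\<^sub>u\<^sub>p k (\<lambda>m. \<zeta> m \<omega>) (\<lambda>m. \<tau>\<^sub>c\<^sub>p k m \<omega>))"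

definition T_min :: "real \<Rightarrow> real \<Rightarrow> real \<Rightarrow> nat \<Rightarrow> real" where
  "T_min \<alpha> \<tau>\<^sub>d\<^sub>o\<^sub>w\<^sub>n \<tau>\<^sub>u\<^sub>p H = \<alpha> * real H + \<tau>\<^sub>d\<^sub>o\<^sub>w\<^sub>n + \<tau>\<^sub>u\<^sub>p"

definition Xi :: "real \<Rightarrow> real \<Rightarrow> real \<Rightarrow> real \<Rightarrow> nat \<Rightarrow> real \<Rightarrow> real" where
  "Xi \<alpha> \<tau>\<^sub>d\<^sub>o\<^sub>w\<^sub>n \<tau>\<^sub>u\<^sub>p T0 H T = min T T0 - T_min \<alpha> \<tau>\<^sub>d\<^sub>o\<^sub>w\<^sub>n \<tau>\<^sub>u\<^sub>p H"

definition Lambda :: "real \<Rightarrow> real \<Rightarrow> real \<Rightarrow> real \<Rightarrow> real \<Rightarrow> real \<Rightarrow> nat \<Rightarrow> real \<Rightarrow> real" where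
  "Lambda rate \<alpha> \<beta> \<tau>\<^sub>d\<^sub>o\<^sub>w\<^sub>n \<tau>\<^sub>u\<^sub>p T0 H T =
     2 * rate * Xi \<alpha> \<tau>\<^sub>d\<^sub>o\<^sub>w\<^sub>n \<tau>\<^sub>u\<^sub>p T0 H T +
     rate * (1 - exp (- (Xi \<alpha> \<tau>\<^sub>d\<^sub>o\<^sub>w\<^sub>n \<tau>\<^sub>u\<^sub>p T0 H T / (\<beta> * real H)))) *
       (\<bar>T - T0\<bar> - 2 * \<beta> * real H)"

end

theory Submission
  imports Defs "HOL-Complex_Analysis.Cauchy_Integral_Formula"
begin

text \<open>
  The successful vehicles are a thinning of the arrival process: given the arrival times, vehicle
  \<open>m\<close> succeeds independently with a probability \<open>p(\<zeta>\<^sub>m)\<close> depending continuously on its arrival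
  time. Hence the generating function of their number is the expectation of
  \<open>\<Prod>\<^sub>m (1 - (1 - s) p(\<zeta>\<^sub>m))\<close>. For a step function \<open>g\<close> the expectation of \<open>\<Prod>\<^sub>m g(\<zeta>\<^sub>m)\<close> is
  \<open>exp (- rate * \<integral>(1 - g))\<close> by the independence of the counts in disjoint intervals, and dominated
  convergence extends this to continuous \<open>g\<close>. This yields the generating function of a Poisson
  distribution with parameter \<open>rate * \<integral>p\<close>.
\<close>

section \<open>Probability generating functions\<close>

text \<open>Bounded coefficients give convergence on the open unit disc, and the zeros of a nonzero
  power series are isolated, while [0,1) accumulates at 0. One-sided information suffices, which
  matters because generating functions are evaluated only for s in [0,1).\<close>

lemma power_series_zero_imp_coeff_zero:
  fixes d :: "nat \<Rightarrow> real"
  assumes bounded: "\<And>n. \<bar>d n\<bar> \<le> B"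
    and zero: "\<And>s. 0 \<le> s \<Longrightarrow> s < 1 \<Longrightarrow> (\<lambda>n. d n * s ^ n) sums 0"
  shows "d n = 0"
proof (rule ccontr)
  assume dn: "d n \<noteq> 0"
  have d0: "d 0 = 0"
    using sums_unique2[OF zero[of 0] powser_sums_zero[of d]] by simp
  with dn have "n > 0" by (cases n) auto
  define f where "f x = (\<Sum>n. d n * x ^ n)" for x
  have sums: "(\<lambda>n. d n * (x - 0) ^ n) sums f x" if "norm (x - 0) < 1" for x :: real
  proof -
    have "summable (\<lambda>n. d n * x ^ n)"
    proof (rule summable_comparison_test)
      show "\<exists>N. \<forall>n\<ge>N. norm (d n * x ^ n) \<le> B * \<bar>x\<bar> ^ n"
        using bounded by (auto simp: abs_mult power_abs intro!: mult_right_mono)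
      show "summable (\<lambda>n. B * \<bar>x\<bar> ^ n)"
        using that by (intro summable_mult summable_geometric) auto
    qed
    then show ?thesis unfolding f_def by (simp add: summable_sums)
  qed
  have f0: "f x = 0" if "0 \<le> x" "x < 1" for x
    using zero[OF that] unfolding f_def by (simp add: sums_iff)
  obtain s where "0 < s" and s: "\<And>z. z \<in> cball 0 s - {0} \<Longrightarrow> f z \<noteq> 0"
    using powser_0_nonzero[OF _ sums _ dn \<open>n > 0\<close>] f0[of 0] by (metis zero_less_one order_refl)
  \<comment> \<open>The point must lie both in the punctured ball and in [0,1); the cap 1/2 ensures
    the latter.\<close>
  then have "min s (1/2) \<in> cball 0 s - {0}" by (auto simp: dist_norm)
  from s[OF this] f0[of "min s (1/2)"] \<open>0 < s\<close> show False by auto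
qed

context prob_space
begin

text \<open>Termwise integration of \<open>s ^ N\<close> split over the events \<open>N = n\<close>;
  s < 1 provides a geometric majorant.\<close>

lemma sums_expectation_power:
  fixes N :: "'a \<Rightarrow> nat" and s :: real
  assumes [measurable]: "N \<in> measurable M (count_space UNIV)" and s: "0 \<le> s" "s < 1"
  shows "(\<lambda>n. prob {\<omega> \<in> space M. N \<omega> = n} * s ^ n) sums expectation (\<lambda>\<omega>. s ^ N \<omega>)"
proof -
  let ?f = "\<lambda>n \<omega>. indicator {\<omega> \<in> space M. N \<omega> = n} \<omega> * s ^ n :: real"
  have eq: "(\<lambda>n. ?f n \<omega>) sums s ^ N \<omega>" if "\<omega> \<in> space M" for \<omega>
    using sums_single[of "N \<omega>" "\<lambda>n. s ^ n"] that
    by (auto simp: indicator_def of_bool_def if_distrib[of "\<lambda>x. x * _"] eq_commute cong: if_cong)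
  have "(\<lambda>n. integral\<^sup>L M (?f n)) sums (\<integral>\<omega>. (\<Sum>n. ?f n \<omega>) \<partial>M)"
  proof (rule sums_integral)
    show "integrable M (?f n)" for n
      by (intro integrable_mult_left integrable_real_indicator) (auto simp: emeasure_eq_measure)
    show "AE \<omega> in M. summable (\<lambda>n. norm (?f n \<omega>))"
      using eq s by (auto simp: abs_mult intro!: AE_I2 sums_summable)
    show "summable (\<lambda>n. \<integral>\<omega>. norm (?f n \<omega>) \<partial>M)"
    proof (rule summable_comparison_test)
      show "\<exists>N'. \<forall>n\<ge>N'. norm (\<integral>\<omega>. norm (?f n \<omega>) \<partial>M) \<le> s ^ n"
        using s by (auto simp: abs_mult mult_left_le_one_le)
      show "summable (\<lambda>n. s ^ n)" using s by (intro summable_geometric) auto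
    qed
  qed
  also have "(\<integral>\<omega>. (\<Sum>n. ?f n \<omega>) \<partial>M) = expectation (\<lambda>\<omega>. s ^ N \<omega>)"
    using eq by (intro Bochner_Integration.integral_cong) (auto simp: sums_iff)
  finally show ?thesis by simp
qed

end

lemma poisson_pgf:
  fixes s :: real
  assumes "\<mu> > 0" "0 \<le> s" "s \<le> 1"
  shows "(\<integral>n. s ^ n \<partial>poisson_pmf \<mu>) = exp (- \<mu> * (1 - s))"
\<comment> \<open>At s = 1 the geometric majorant is lost, but both sides are trivially 1.\<close>
proof (cases "s = 1")
  case False
  have "(\<lambda>n. pmf (poisson_pmf \<mu>) n * s ^ n) sums (\<integral>n. s ^ n \<partial>poisson_pmf \<mu>)"
    using measure_pmf.sums_expectation_power[where N="\<lambda>n. n" and s=s] assms False by (simp add: pmf.rep_eq)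
  moreover have "(\<lambda>n. exp (- \<mu>) * (inverse (fact n) * (\<mu> * s) ^ n)) sums (exp (- \<mu>) * exp (\<mu> * s))"
    by (intro sums_mult) (use exp_converges[of "\<mu> * s"] in simp)
  then have "(\<lambda>n. pmf (poisson_pmf \<mu>) n * s ^ n) sums (exp (- \<mu>) * exp (\<mu> * s))"
    using assms by (simp add: power_mult_distrib field_simps)
  ultimately show ?thesis
    by (simp add: sums_unique2 exp_add[symmetric] algebra_simps)
qed simp

text \<open>The difference of the two probability mass functions is bounded by 1 and its power
  series vanishes on [0,1), so it is zero.\<close>

lemma (in prob_space) distr_eq_poissonI:
  assumes N[measurable]: "N \<in> measurable M (count_space UNIV)" and "\<mu> > 0"
    and pgf: "\<And>s::real. 0 \<le> s \<Longrightarrow> s < 1 \<Longrightarrow> expectation (\<lambda>\<omega>. s ^ N \<omega>) = exp (- \<mu> * (1 - s))"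
  shows "distr M (count_space UNIV) N = measure_pmf (poisson_pmf \<mu>)"
proof (rule measure_eqI_countable[of _ UNIV])
  let ?d = "\<lambda>n. prob {\<omega> \<in> space M. N \<omega> = n} - pmf (poisson_pmf \<mu>) n"
  fix n
  have "?d n = 0"
  proof (rule power_series_zero_imp_coeff_zero[of ?d 1])
    show "\<bar>?d n\<bar> \<le> 1" for n
      using pmf_nonneg[of "poisson_pmf \<mu>" n] pmf_le_1[of "poisson_pmf \<mu>" n]
        prob_le_1[of "{\<omega> \<in> space M. N \<omega> = n}"] measure_nonneg[of M "{\<omega> \<in> space M. N \<omega> = n}"]
      unfolding abs_le_iff by linarith
    fix s :: real assume s: "0 \<le> s" "s < 1"
    have "(\<lambda>n. pmf (poisson_pmf \<mu>) n * s ^ n) sums (\<integral>n. s ^ n \<partial>poisson_pmf \<mu>)"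
      using measure_pmf.sums_expectation_power[where N="\<lambda>n. n" and s=s] s by (simp add: pmf.rep_eq)
    from sums_diff[OF sums_expectation_power[OF N s] this]
    show "(\<lambda>n. ?d n * s ^ n) sums 0"
      using pgf[OF s] poisson_pgf[OF \<open>\<mu> > 0\<close>, of s] s by (simp add: left_diff_distrib)
  qed
  then have "prob {\<omega> \<in> space M. N \<omega> = n} = measure (measure_pmf (poisson_pmf \<mu>)) {n}"
    by (simp add: pmf.rep_eq)
  then show "emeasure (distr M (count_space UNIV) N) {n} = emeasure (measure_pmf (poisson_pmf \<mu>)) {n}"
    by (subst emeasure_distr)
      (auto simp: emeasure_eq_measure measure_pmf.emeasure_eq_measure vimage_def Int_def conj_commute)
qed auto

section \<open>Multiplicative functionals of a Poisson process\<close>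

lemma grid_cell_exists:
  fixes t :: "nat \<Rightarrow> real"
  assumes "x \<in> {t 0<..t n}"
  shows "\<exists>i<n. x \<in> {t i<..t (Suc i)}"
  using assms
proof (induction n)
  case (Suc n)
  then show ?case by (cases "x \<le> t n") (auto simp: less_Suc_eq)
qed auto

lemma grid_cell_unique:
  fixes t :: "nat \<Rightarrow> real"
  assumes "mono t" "x \<in> {t i<..t (Suc i)}" "x \<in> {t j<..t (Suc j)}"
  shows "i = j"
proof (rule ccontr)
  assume "i \<noteq> j"
  then have "Suc i \<le> j \<or> Suc j \<le> i" by auto
  then have "t (Suc i) \<le> t j \<or> t (Suc j) \<le> t i" using monoD[OF \<open>mono t\<close>] by blast
  with assms show False by auto
qed

text \<open>The cells are half-open because those are the intervals whose counts are independent by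
  the definition of the Poisson process.\<close>

definition left_step :: "(nat \<Rightarrow> real) \<Rightarrow> nat \<Rightarrow> (real \<Rightarrow> real) \<Rightarrow> real \<Rightarrow> real" where
  "left_step t n f x = (\<Sum>i<n. f (t i) * indicator {t i<..t (Suc i)} x)"

lemma left_step_eq:
  assumes "mono t" "i < n" "x \<in> {t i<..t (Suc i)}"
  shows "left_step t n f x = f (t i)"
proof -
  have "left_step t n f x = (\<Sum>j<n. if j = i then f (t j) else 0)"
    unfolding left_step_def
  proof (intro sum.cong refl)
    fix j
    have "x \<in> {t j<..t (Suc j)} \<longleftrightarrow> j = i"
      using assms(3) grid_cell_unique[OF \<open>mono t\<close> _ assms(3)] by blast
    then show "f (t j) * indicator {t j<..t (Suc j)} x = (if j = i then f (t j) else 0)"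
      by (simp add: indicator_def)
  qed
  then show ?thesis using \<open>i < n\<close> by simp
qed

lemma left_step_outside:
  assumes "mono t" "x \<notin> {t 0<..t n}"
  shows "left_step t n f x = 0"
proof -
  have "x \<notin> {t i<..t (Suc i)}" if "i < n" for i
    using that assms monoD[OF \<open>mono t\<close>, of 0 i] monoD[OF \<open>mono t\<close>, of "Suc i" n] by auto
  then show ?thesis unfolding left_step_def by (intro sum.neutral) (auto simp: indicator_def)
qed

lemma left_step_between:
  assumes "mono t" "\<And>x. x \<in> {t 0..t n} \<Longrightarrow> 0 \<le> f x \<and> f x \<le> 1"
  shows "0 \<le> left_step t n f x \<and> left_step t n f x \<le> 1"
proof (cases "x \<in> {t 0<..t n}")
  case True
  then obtain i where i: "i < n" "x \<in> {t i<..t (Suc i)}" using grid_cell_exists by blast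
  then have "t i \<in> {t 0..t n}" 
    using monoD[OF \<open>mono t\<close>, of 0 i] monoD[OF \<open>mono t\<close>, of i n] by simp
  then show ?thesis using left_step_eq[OF \<open>mono t\<close> i] assms(2) by simp
qed (simp add: left_step_outside[OF \<open>mono t\<close>])

lemma left_step_measurable [measurable]: "left_step t n f \<in> borel_measurable borel"
  unfolding left_step_def by measurable

lemma integral_left_step:
  assumes "mono t"
  shows "(\<integral>x. left_step t n f x \<partial>lborel) = (\<Sum>i<n. f (t i) * (t (Suc i) - t i))"
proof -
  have le: "t i \<le> t (Suc i)" for i using monoD[OF \<open>mono t\<close>] by simp
  have "(\<integral>x. left_step t n f x \<partial>lborel) =
      (\<Sum>i<n. \<integral>x. f (t i) * indicator {t i<..t (Suc i)} x \<partial>lborel)"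
    unfolding left_step_def
    by (rule Bochner_Integration.integral_sum)
      (auto simp: le intro!: integrable_mult_right integrable_real_indicator)
  also have "\<dots> = (\<Sum>i<n. f (t i) * (t (Suc i) - t i))"
    by (simp add: le)
  finally show ?thesis .
qed

text \<open>Using \<open>Suc n\<close> cells avoids division by zero. The grid runs on beyond
  \<open>b\<close>, since independence of the counts is stated for sequences monotone on all
  naturals.\<close>

definition uniform_grid :: "real \<Rightarrow> real \<Rightarrow> nat \<Rightarrow> nat \<Rightarrow> real" where
  "uniform_grid a b n i = a + real i * ((b - a) / real (Suc n))"

lemma uniform_grid_simps [simp]:
  "uniform_grid a b n 0 = a" "uniform_grid a b n (Suc n) = b"
  by (simp_all add: uniform_grid_def)

lemma strict_mono_uniform_grid: "a < b \<Longrightarrow> strict_mono (uniform_grid a b n)"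
  unfolding strict_mono_def uniform_grid_def
  by (intro allI impI add_strict_left_mono mult_strict_right_mono divide_pos_pos) auto

text \<open>The step function takes at \<open>x\<close> the value of \<open>f\<close> at a left
  endpoint no farther from \<open>x\<close> than the mesh, so continuity gives pointwise
  convergence. The point \<open>a\<close> is excluded because it lies in no cell.\<close>

lemma left_step_tendsto:
  assumes "a < b" and cont: "continuous_on {a..b} f" and x: "x \<in> {a<..b}"
  shows "(\<lambda>n. left_step (uniform_grid a b n) (Suc n) f x) \<longlonglongrightarrow> f x"
proof -
  have mono: "mono (uniform_grid a b n)" for n
    using strict_mono_uniform_grid[OF \<open>a < b\<close>] by (rule strict_mono_mono)
  have "\<exists>y. left_step (uniform_grid a b n) (Suc n) f x = f y \<and> y \<in> {a..b} \<and>
      \<bar>y - x\<bar> \<le> (b - a) / real (Suc n)" for n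
  proof -
    let ?t = "uniform_grid a b n"
    obtain i where i: "i < Suc n" "x \<in> {?t i<..?t (Suc i)}"
      using grid_cell_exists[of x ?t "Suc n"] x by auto
    have "?t (Suc i) - ?t i = (b - a) / real (Suc n)"
      unfolding uniform_grid_def by (simp add: algebra_simps del: of_nat_Suc flip: add_divide_distrib) (simp add: algebra_simps)
    moreover have "?t i \<in> {a..b}"
      using i(1) monoD[OF mono, of 0 i n] monoD[OF mono, of i "Suc n" n] by simp
    ultimately show ?thesis using left_step_eq[OF mono i] i(2) by (intro exI[of _ "?t i"]) auto
  qed
  then obtain y where y: "\<And>n. left_step (uniform_grid a b n) (Suc n) f x = f (y n)"
    "\<And>n. y n \<in> {a..b}" "\<And>n. \<bar>y n - x\<bar> \<le> (b - a) / real (Suc n)" by metis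
  have "y \<longlonglongrightarrow> x"
  proof (rule Lim_transform2[OF tendsto_const])
    have "(\<lambda>n. y n - x) \<longlonglongrightarrow> 0"
    proof (rule Lim_null_comparison)
      show "\<forall>\<^sub>F n in sequentially. norm (y n - x) \<le> (b - a) / real (Suc n)"
        using y(3) by simp
      show "(\<lambda>n. (b - a) / real (Suc n)) \<longlonglongrightarrow> 0"
        by (intro real_tendsto_divide_at_top[OF tendsto_const] filterlim_compose[OF filterlim_real_sequentially filterlim_Suc])
    qed
    then show "(\<lambda>n. x - y n) \<longlonglongrightarrow> 0" using tendsto_minus by fastforce
  qed
  then have "(\<lambda>n. f (y n)) \<longlonglongrightarrow> f x"
    using continuous_on_tendsto_compose[OF cont, of y x sequentially] x y(2) by auto
  then show ?thesis by (simp add: y(1))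
qed

text \<open>Grouping the points by cell turns a product over random points into a product of powers
  of the cell counts, to which independence applies.\<close>

lemma prod_left_step:
  assumes "mono t" and fin: "finite {m. z m \<in> {t 0<..t n}}"
  shows "(\<Prod>m\<in>{m. z m \<in> {t 0<..t n}}. left_step t n f (z m)) =
    (\<Prod>i<n. f (t i) ^ card {m. z m \<in> {t i<..t (Suc i)}})"
proof -
  let ?C = "\<lambda>i. {m. z m \<in> {t i<..t (Suc i)}}"
  have sub: "?C i \<subseteq> {m. z m \<in> {t 0<..t n}}" if "i < n" for i
    using that monoD[OF \<open>mono t\<close>, of 0 i] monoD[OF \<open>mono t\<close>, of "Suc i" n] by auto
  have "{m. z m \<in> {t 0<..t n}} = (\<Union>i<n. ?C i)"
  proof
    show "{m. z m \<in> {t 0<..t n}} \<subseteq> (\<Union>i<n. ?C i)"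
      using grid_cell_exists[of _ t n] by fastforce
    show "(\<Union>i<n. ?C i) \<subseteq> {m. z m \<in> {t 0<..t n}}" using sub by blast
  qed
  then have "(\<Prod>m\<in>{m. z m \<in> {t 0<..t n}}. left_step t n f (z m)) =
      (\<Prod>m\<in>(\<Union>i<n. ?C i). left_step t n f (z m))" by simp
  also have "\<dots> = (\<Prod>i<n. \<Prod>m\<in>?C i. left_step t n f (z m))"
  proof (rule prod.UNION_disjoint)
    show "\<forall>i\<in>{..<n}. finite (?C i)" using finite_subset[OF sub fin] by blast
    show "\<forall>i\<in>{..<n}. \<forall>j\<in>{..<n}. i \<noteq> j \<longrightarrow> ?C i \<inter> ?C j = {}"
      using grid_cell_unique[OF \<open>mono t\<close>] by blast
  qed simp
  also have "\<dots> = (\<Prod>i<n. f (t i) ^ card (?C i))"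
    by (intro prod.cong refl) (simp add: left_step_eq[OF \<open>mono t\<close>])
  finally show ?thesis .
qed

section \<open>Expectation of products over the points of a Poisson process\<close>

context prob_space
begin

lemma poisson_process_finite:
  assumes "homogeneous_poisson_process rate Z"
  shows "AE \<omega> in M. finite {m. Z m \<omega> \<in> {a<..b}}"
proof -
  have "AE \<omega> in M. \<forall>a b. finite {m. Z m \<omega> \<in> {a..b}}"
    using assms unfolding homogeneous_poisson_process_def by blast
  then show ?thesis
    by eventually_elim (rule finite_subset[of _ "{m. Z m _ \<in> {a..b}}"], auto)
qed

lemma poisson_process_indep_counts:
  assumes "homogeneous_poisson_process rate Z" "mono t"
  shows "indep_vars (\<lambda>_. count_space UNIV) (\<lambda>i. point_count Z {t i<..t (Suc i)}) UNIV"
  using assms unfolding homogeneous_poisson_process_def by blast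

text \<open>Independence factorizes the expectation, and each factor is a Poisson generating
  function at \<open>h i\<close>. The grid is strictly increasing so that every cell has positive
  length, as the Poisson law of a count is given only for such intervals.\<close>

lemma poisson_process_step_functional:
  assumes pp: "homogeneous_poisson_process rate Z" and "rate > 0" "strict_mono t"
    and h: "\<And>i. i < n \<Longrightarrow> 0 \<le> h i \<and> h i \<le> 1"
  shows "expectation (\<lambda>\<omega>. \<Prod>i<n. h i ^ point_count Z {t i<..t (Suc i)} \<omega>) =
    exp (- rate * (\<Sum>i<n. (1 - h i) * (t (Suc i) - t i)))"
proof -
  let ?N = "\<lambda>i. point_count Z {t i<..t (Suc i)}"
  note indep = poisson_process_indep_counts[OF pp strict_mono_mono[OF \<open>strict_mono t\<close>]]
  then have rv [measurable]: "?N i \<in> measurable M (count_space UNIV)" for i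
    unfolding indep_vars_def by simp
  have "expectation (\<lambda>\<omega>. \<Prod>i<n. h i ^ ?N i \<omega>) = (\<Prod>i<n. expectation (\<lambda>\<omega>. h i ^ ?N i \<omega>))"
  proof (rule indep_vars_lebesgue_integral)
    show "indep_vars (\<lambda>_. borel) (\<lambda>i \<omega>. h i ^ ?N i \<omega>) {..<n}"
      by (rule indep_vars_compose2[OF indep_vars_subset[OF indep]]) auto
    show "integrable M (\<lambda>\<omega>. h i ^ ?N i \<omega>)" if "i \<in> {..<n}" for i
      using h[of i] that by (intro integrable_const_bound[of _ 1]) (auto simp: power_le_one)
  qed simp
  also have "\<dots> = (\<Prod>i<n. exp (- rate * ((1 - h i) * (t (Suc i) - t i))))"
  proof (intro prod.cong refl)
    fix i assume "i \<in> {..<n}"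
    have "t i < t (Suc i)" using \<open>strict_mono t\<close> by (simp add: strict_mono_def)
    then have "distr M (count_space UNIV) (?N i) = poisson_pmf (rate * (t (Suc i) - t i))"
      using pp unfolding homogeneous_poisson_process_def by blast
    moreover have "expectation (\<lambda>\<omega>. h i ^ ?N i \<omega>) = (\<integral>k. h i ^ k \<partial>distr M (count_space UNIV) (?N i))"
      by (rule integral_distr[symmetric]) auto
    ultimately show "expectation (\<lambda>\<omega>. h i ^ ?N i \<omega>) = exp (- rate * ((1 - h i) * (t (Suc i) - t i)))"
      using poisson_pgf[of "rate * (t (Suc i) - t i)" "h i"] h[of i] \<open>i \<in> {..<n}\<close> \<open>t i < t (Suc i)\<close> \<open>rate > 0\<close>
      by (simp add: mult_ac)
  qed
  also have "\<dots> = exp (- rate * (\<Sum>i<n. (1 - h i) * (t (Suc i) - t i)))"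
    by (simp add: exp_sum[symmetric] sum_distrib_left sum_negf)
  finally show ?thesis .
qed

text \<open>The product over the points need not be known to be measurable, hence the representative \<open>X\<close>.\<close>
lemma poisson_process_functional:
  assumes pp: "homogeneous_poisson_process rate Z" and "rate > 0" "a < b"
    and cont: "continuous_on {a..b} g"
    and g01: "\<And>x. x \<in> {a..b} \<Longrightarrow> 0 \<le> g x \<and> g x \<le> 1"
    and X [measurable]: "random_variable borel X"
    and X_eq: "AE \<omega> in M. X \<omega> = (\<Prod>m\<in>{m. Z m \<omega> \<in> {a<..b}}. g (Z m \<omega>))"
  shows "expectation X = exp (- rate * (LINT x:{a<..b}|lborel. 1 - g x))"
proof (rule LIMSEQ_unique)
  let ?t = "uniform_grid a b"
  have strict: "strict_mono (?t n)" for n using strict_mono_uniform_grid[OF \<open>a < b\<close>] .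
  have mono: "mono (?t n)" for n using strict by (rule strict_mono_mono)
  note fin = poisson_process_finite[OF pp, of a b]
  have rv: "point_count Z {?t n i<..?t n (Suc i)} \<in> measurable M (count_space UNIV)" for n i
    using poisson_process_indep_counts[OF pp mono[of n]] unfolding indep_vars_def by simp
  have grid: "?t n i \<in> {a..b}" if "i < Suc n" for n i
    using that monoD[OF mono, of 0 i n] monoD[OF mono, of i "Suc n" n] by simp
  have cont': "continuous_on {a..b} (\<lambda>x. 1 - g x)" using cont by (intro continuous_intros)
  \<comment> \<open>Written through the counts, \<open>Y n\<close> is measurable; whenever the
    interval contains finitely many points it is the product of step function values. Both sides of
    the claim are limits of its expectation.\<close>
  define Y where "Y n \<omega> = (\<Prod>i<Suc n. g (?t n i) ^ point_count Z {?t n i<..?t n (Suc i)} \<omega>)" for n \<omega>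
  have Y_eq: "Y n \<omega> = (\<Prod>m\<in>{m. Z m \<omega> \<in> {a<..b}}. left_step (?t n) (Suc n) g (Z m \<omega>))"
    if "finite {m. Z m \<omega> \<in> {a<..b}}" for n \<omega>
    using prod_left_step[OF mono, of "\<lambda>m. Z m \<omega>" n "Suc n" g] that
    by (simp add: Y_def point_count_def)
  show "(\<lambda>n. expectation (Y n)) \<longlonglongrightarrow> expectation X"
  proof (rule integral_dominated_convergence[where w = "\<lambda>_. 1"])
    show "Y n \<in> borel_measurable M" for n unfolding Y_def using rv by measurable
    show "AE \<omega> in M. (\<lambda>n. Y n \<omega>) \<longlonglongrightarrow> X \<omega>"
      using X_eq fin
    proof eventually_elim
      case (elim \<omega>)
      then show ?case
        using left_step_tendsto[OF \<open>a < b\<close> cont] by (auto simp: Y_eq intro!: tendsto_prod)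
    qed
    show "AE \<omega> in M. norm (Y n \<omega>) \<le> 1" for n
      using fin
    proof eventually_elim
      case (elim \<omega>)
      have "\<bar>\<Prod>m\<in>{m. Z m \<omega> \<in> {a<..b}}. left_step (?t n) (Suc n) g (Z m \<omega>)\<bar> \<le> 1"
        using left_step_between[OF mono[of n], of "Suc n" g] g01
        by (auto simp: abs_prod intro!: prod_le_1)
      then show ?case by (simp add: Y_eq[OF elim])
    qed
  qed auto
  \<comment> \<open>The step function is formed from \<open>1 - g\<close>, so it vanishes off the
    interval; one minus the step function of \<open>g\<close> would be 1 there and not
    integrable.\<close>
  have EY: "expectation (Y n) = exp (- rate * (\<integral>x. left_step (?t n) (Suc n) (\<lambda>x. 1 - g x) x \<partial>lborel))" for n
    unfolding Y_def integral_left_step[OF mono]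
    by (rule poisson_process_step_functional[OF pp \<open>rate > 0\<close> strict]) (use g01 grid in auto)
  have "(\<lambda>n. \<integral>x. left_step (?t n) (Suc n) (\<lambda>x. 1 - g x) x \<partial>lborel) \<longlonglongrightarrow> (LINT x:{a<..b}|lborel. 1 - g x)"
    unfolding set_lebesgue_integral_def
  proof (rule integral_dominated_convergence[where w = "indicator {a..b}"])
    show "(\<lambda>x. indicator {a<..b} x *\<^sub>R (1 - g x)) \<in> borel_measurable lborel"
      using borel_measurable_continuous_on_indicator[OF _ continuous_on_subset[OF cont', of "{a<..b}"]]
      by (simp add: greaterThanAtMost_subseteq_atLeastAtMost_iff)
    show "AE x in lborel. (\<lambda>n. left_step (?t n) (Suc n) (\<lambda>x. 1 - g x) x)
        \<longlonglongrightarrow> indicator {a<..b} x *\<^sub>R (1 - g x)"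
    proof (rule AE_I2)
      fix x
      show "(\<lambda>n. left_step (?t n) (Suc n) (\<lambda>x. 1 - g x) x) \<longlonglongrightarrow> indicator {a<..b} x *\<^sub>R (1 - g x)"
        using left_step_tendsto[OF \<open>a < b\<close> cont', of x] left_step_outside[OF mono, of x _ "Suc _"]
        by (cases "x \<in> {a<..b}") auto
    qed
    show "AE x in lborel. norm (left_step (?t n) (Suc n) (\<lambda>x. 1 - g x) x) \<le> indicator {a..b} x" for n
    proof (rule AE_I2)
      fix x
      show "norm (left_step (?t n) (Suc n) (\<lambda>x. 1 - g x) x) \<le> indicator {a..b} x"
        using left_step_between[OF mono[of n], of "Suc n" "\<lambda>x. 1 - g x" x] g01
          left_step_outside[OF mono, of x n "Suc n"]
        by (cases "x \<in> {a<..b}") auto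
    qed
  qed (use \<open>a < b\<close> in \<open>auto intro!: integrable_real_indicator\<close>)
  then show "(\<lambda>n. expectation (Y n)) \<longlonglongrightarrow> exp (- rate * (LINT x:{a<..b}|lborel. 1 - g x))"
    unfolding EY by (intro tendsto_intros)
qed

end

section \<open>Thinning\<close>

text \<open>The injection \<open>to_nat\<close> preserves cardinalities and reduces the claim to
  sets of naturals. A natural outside its range belongs to no image and gives the empty
  event.\<close>

lemma measurable_card_countable:
  fixes S :: "'a \<Rightarrow> 'v::countable set"
  assumes [measurable]: "\<And>i. {x \<in> space M. i \<in> S x} \<in> sets M"
  shows "(\<lambda>x. card (S x)) \<in> measurable M (count_space UNIV)"
proof -
  have "{x \<in> space M. j \<in> to_nat ` S x} \<in> sets M" for j
  proof (cases "j \<in> range (to_nat :: 'v \<Rightarrow> nat)")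
    case True
    then obtain i :: 'v where "j = to_nat i" by blast
    then have "{x \<in> space M. j \<in> to_nat ` S x} = {x \<in> space M. i \<in> S x}" by (auto simp: inj_image_mem_iff)
    then show ?thesis by simp
  next
    case False
    then have "j \<notin> to_nat ` S x" for x by blast
    then show ?thesis by simp
  qed
  then have "(\<lambda>x. card (to_nat ` S x)) \<in> measurable M (count_space UNIV)"
    by (rule measurable_card)
  then show ?thesis by (simp add: card_image)
qed

context prob_space
begin

text \<open>This is thinning with the arrival times frozen: \<open>s ^ card\<close> is a product of
  independent factors, equal to s for an accepted label and 1 otherwise.\<close>

lemma expectation_power_card_indep:
  assumes "finite F" and indep: "indep_vars (\<lambda>_. N) C F"
    and B: "\<And>m. m \<in> F \<Longrightarrow> B m \<in> sets N"
    and s: "0 \<le> s" "s \<le> 1"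
  shows "expectation (\<lambda>\<omega>. s ^ card {m \<in> F. C m \<omega> \<in> B m}) =
    (\<Prod>m\<in>F. 1 - (1 - s) * prob {\<omega> \<in> space M. C m \<omega> \<in> B m})"
proof -
  let ?Y = "\<lambda>m c. 1 - (1 - s) * indicator (B m) c :: real"
  have rv [measurable]: "C m \<in> measurable M N" if "m \<in> F" for m
    using indep that unfolding indep_vars_def by simp
  have eq: "s ^ card {m \<in> F. C m \<omega> \<in> B m} = (\<Prod>m\<in>F. ?Y m (C m \<omega>))" for \<omega>
  proof -
    have "(\<Prod>m\<in>F. ?Y m (C m \<omega>)) = (\<Prod>m\<in>F. if C m \<omega> \<in> B m then s else 1)"
      by (intro prod.cong) (auto simp: indicator_def)
    also have "\<dots> = s ^ card {m \<in> F. C m \<omega> \<in> B m}"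
      using \<open>finite F\<close> by (simp add: prod.inter_filter[symmetric])
    finally show ?thesis by simp
  qed
  have "expectation (\<lambda>\<omega>. \<Prod>m\<in>F. ?Y m (C m \<omega>)) = (\<Prod>m\<in>F. expectation (\<lambda>\<omega>. ?Y m (C m \<omega>)))"
  proof (rule indep_vars_lebesgue_integral[OF \<open>finite F\<close>])
    show "indep_vars (\<lambda>_. borel) (\<lambda>m \<omega>. ?Y m (C m \<omega>)) F"
    proof (rule indep_vars_compose2[OF indep])
      fix m assume "m \<in> F"
      note [measurable] = B[OF this]
      show "?Y m \<in> borel_measurable N" by measurable
    qed
    show "integrable M (\<lambda>\<omega>. ?Y m (C m \<omega>))" if "m \<in> F" for m
    proof (rule integrable_const_bound[of _ 1])
      note [measurable] = B[OF that] rv[OF that]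
      show "(\<lambda>\<omega>. ?Y m (C m \<omega>)) \<in> borel_measurable M" by measurable
    qed (use s in \<open>auto simp: indicator_def\<close>)
  qed
  also have "\<dots> = (\<Prod>m\<in>F. 1 - (1 - s) * prob {\<omega> \<in> space M. C m \<omega> \<in> B m})"
  proof (intro prod.cong refl)
    fix m assume "m \<in> F"
    note [measurable] = B[OF this] rv[OF this]
    have "expectation (\<lambda>\<omega>. ?Y m (C m \<omega>)) =
        expectation (\<lambda>\<omega>. 1 - (1 - s) * indicator {\<omega> \<in> space M. C m \<omega> \<in> B m} \<omega>)"
      by (intro Bochner_Integration.integral_cong) (auto simp: indicator_def)
    also have "\<dots> = 1 - (1 - s) * prob {\<omega> \<in> space M. C m \<omega> \<in> B m}"
      by (subst Bochner_Integration.integral_diff)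
        (auto simp: prob_space intro!: integrable_mult_right integrable_real_indicator simp: emeasure_eq_measure)
    finally show "expectation (\<lambda>\<omega>. ?Y m (C m \<omega>)) = 1 - (1 - s) * prob {\<omega> \<in> space M. C m \<omega> \<in> B m}" .
  qed
  finally show ?thesis by (simp add: eq)
qed

text \<open>The set \<open>A\<close> encodes acceptance of a point with its mark. The marks enter
  only through the acceptance probability \<open>p x\<close>, which is the same for all
  labels.\<close>

theorem poisson_process_thinning:
  fixes Z :: "'v::countable \<Rightarrow> 'a \<Rightarrow> real" and C :: "'v \<Rightarrow> 'a \<Rightarrow> real"
  assumes pp: "homogeneous_poisson_process rate Z" and "rate > 0" "a < b"
    and marks: "indep_vars (\<lambda>_. borel) C UNIV"
    and indep: "indep_var (Pi\<^sub>M UNIV (\<lambda>_. borel)) (\<lambda>\<omega> m. Z m \<omega>) (Pi\<^sub>M UNIV (\<lambda>_. borel)) (\<lambda>\<omega> m. C m \<omega>)"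
    and A [measurable]: "A \<in> sets (borel \<Otimes>\<^sub>M borel)"
    and p: "\<And>m x. x \<in> {a..b} \<Longrightarrow> prob {\<omega> \<in> space M. (x, C m \<omega>) \<in> A} = p x"
    and cont: "continuous_on {a..b} p"
    and pos: "(LINT x:{a<..b}|lborel. p x) > 0"
  defines "K \<equiv> \<lambda>\<omega>. card {m. Z m \<omega> \<in> {a<..b} \<and> (Z m \<omega>, C m \<omega>) \<in> A}"
  shows "K \<in> measurable M (count_space UNIV)" (is ?meas)
    and "distr M (count_space UNIV) K = measure_pmf (poisson_pmf (rate * (LINT x:{a<..b}|lborel. p x)))"
proof -
  let ?PZ = "Pi\<^sub>M UNIV (\<lambda>_::'v. borel :: real measure)" and ?PC = "Pi\<^sub>M UNIV (\<lambda>_::'v. borel :: real measure)"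
  let ?DZ = "distr M ?PZ (\<lambda>\<omega> m. Z m \<omega>)" and ?DC = "distr M ?PC (\<lambda>\<omega> m. C m \<omega>)"
  \<comment> \<open>The count as a function on the product of the two configuration spaces, where
    independence makes the joint law a product measure.\<close>
  define k where "k w = card {m. fst w m \<in> {a<..b} \<and> (fst w m, snd w m) \<in> A}" for w :: "('v \<Rightarrow> real) \<times> ('v \<Rightarrow> real)"
  have rvZ [measurable]: "(\<lambda>\<omega> m. Z m \<omega>) \<in> measurable M ?PZ"
    and rvC [measurable]: "(\<lambda>\<omega> m. C m \<omega>) \<in> measurable M ?PC"
    using indep by (auto dest: indep_var_rv1 indep_var_rv2)
  have k [measurable]: "k \<in> measurable (?PZ \<Otimes>\<^sub>M ?PC) (count_space UNIV)"
    unfolding k_def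
  proof (rule measurable_card_countable, unfold mem_Collect_eq)
    fix m :: 'v
    show "{w \<in> space (?PZ \<Otimes>\<^sub>M ?PC). fst w m \<in> {a<..b} \<and> (fst w m, snd w m) \<in> A} \<in> sets (?PZ \<Otimes>\<^sub>M ?PC)"
      by measurable
  qed
  have K_eq: "K \<omega> = k (\<lambda>m. Z m \<omega>, \<lambda>m. C m \<omega>)" for \<omega>
    unfolding K_def k_def by simp
  show meas: ?meas unfolding K_eq[abs_def] by measurable
  interpret DZ: prob_space ?DZ by (rule prob_space_distr) simp
  interpret DC: prob_space ?DC by (rule prob_space_distr) simp
  interpret P: pair_prob_space ?DZ ?DC ..
  note fin = poisson_process_finite[OF pp, of a b]
  \<comment> \<open>Any label serves here, since \<open>p x\<close> is a probability for each of
    them.\<close>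
  have p01: "0 \<le> p x \<and> p x \<le> 1" if "x \<in> {a..b}" for x
    by (simp add: p[OF that, of undefined, symmetric])
  have slice: "{c. (x, c) \<in> A} \<in> sets borel" for x
    by measurable
  show "distr M (count_space UNIV) K = measure_pmf (poisson_pmf (rate * (LINT x:{a<..b}|lborel. p x)))"
  proof (rule distr_eq_poissonI[OF meas])
    show "0 < rate * (LINT x:{a<..b}|lborel. p x)" using \<open>rate > 0\<close> pos by simp
    fix s :: real assume s: "0 \<le> s" "s < 1"
    \<comment> \<open>The conditional generating function given the arrival configuration
      \<open>z\<close>. As a partial integral it is measurable, so it can act as the representative
      \<open>X\<close> in \<open>poisson_process_functional\<close>.\<close>
    let ?X = "\<lambda>z. \<integral>c. s ^ k (z, c) \<partial>?DC"
    have "expectation (\<lambda>\<omega>. s ^ K \<omega>) = (\<integral>w. s ^ k w \<partial>distr M (?PZ \<Otimes>\<^sub>M ?PC) (\<lambda>\<omega>. (\<lambda>m. Z m \<omega>, \<lambda>m. C m \<omega>)))"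
      unfolding K_eq by (subst integral_distr) auto
    also have "\<dots> = (\<integral>w. s ^ k w \<partial>(?DZ \<Otimes>\<^sub>M ?DC))"
      using indep unfolding indep_var_distribution_eq by simp
    also have "\<dots> = (\<integral>z. ?X z \<partial>?DZ)"
    proof (rule P.integral_fst'[symmetric])
      show "integrable (?DZ \<Otimes>\<^sub>M ?DC) (\<lambda>w. s ^ k w)"
        using s by (intro P.integrable_const_bound[of _ 1]) (auto simp: power_le_one)
    qed
    also have "\<dots> = expectation (\<lambda>\<omega>. ?X (\<lambda>m. Z m \<omega>))"
      by (rule integral_distr) measurable
    also have "\<dots> = exp (- rate * (LINT x:{a<..b}|lborel. 1 - (1 - (1 - s) * p x)))"
    proof (rule poisson_process_functional[OF pp \<open>rate > 0\<close> \<open>a < b\<close>])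
      show "continuous_on {a..b} (\<lambda>x. 1 - (1 - s) * p x)" using cont by (intro continuous_intros)
      show "0 \<le> 1 - (1 - s) * p x \<and> 1 - (1 - s) * p x \<le> 1" if "x \<in> {a..b}" for x
        using p01[OF that] s mult_le_one[of "1 - s" "p x"] by auto
      show "(\<lambda>\<omega>. ?X (\<lambda>m. Z m \<omega>)) \<in> borel_measurable M" by measurable
      show "AE \<omega> in M. ?X (\<lambda>m. Z m \<omega>) = (\<Prod>m\<in>{m. Z m \<omega> \<in> {a<..b}}. 1 - (1 - s) * p (Z m \<omega>))"
        using fin
      proof eventually_elim
        case (elim \<omega>)
        let ?F = "{m. Z m \<omega> \<in> {a<..b}}" and ?B = "\<lambda>m. {c. (Z m \<omega>, c) \<in> A}"
        \<comment> \<open>Arrivals stay fixed at \<open>\<omega>\<close> while the marks vary with a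
          separate outcome \<open>\<omega>'\<close>, so each label is accepted when its mark falls
          in a fixed Borel set.\<close>
        have "?X (\<lambda>m. Z m \<omega>) = expectation (\<lambda>\<omega>'. s ^ k (\<lambda>m. Z m \<omega>, \<lambda>m. C m \<omega>'))"
        proof (rule integral_distr[OF rvC])
          have "(\<lambda>c. k (\<lambda>m. Z m \<omega>, c)) \<in> measurable ?PC (count_space UNIV)"
            by (rule measurable_compose[OF measurable_Pair1' k]) (simp add: space_PiM)
          then show "(\<lambda>c. s ^ k (\<lambda>m. Z m \<omega>, c)) \<in> borel_measurable ?PC" by measurable
        qed
        also have "\<dots> = expectation (\<lambda>\<omega>'. s ^ card {m \<in> ?F. C m \<omega>' \<in> ?B m})"
          by (intro Bochner_Integration.integral_cong refl) (simp add: k_def)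
        also have "\<dots> = (\<Prod>m\<in>?F. 1 - (1 - s) * prob {\<omega>' \<in> space M. C m \<omega>' \<in> ?B m})"
          using elim s indep_vars_subset[OF marks] slice
          by (intro expectation_power_card_indep) auto
        also have "\<dots> = (\<Prod>m\<in>?F. 1 - (1 - s) * p (Z m \<omega>))"
        proof (intro prod.cong refl)
          fix m assume "m \<in> ?F"
          have "{\<omega>' \<in> space M. C m \<omega>' \<in> ?B m} = {\<omega>' \<in> space M. (Z m \<omega>, C m \<omega>') \<in> A}"
            by simp
          then show "1 - (1 - s) * prob {\<omega>' \<in> space M. C m \<omega>' \<in> ?B m} = 1 - (1 - s) * p (Z m \<omega>)"
            using p[of "Z m \<omega>" m] \<open>m \<in> ?F\<close> by simp
        qed
        finally show ?case .
      qed
    qed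
    also have "\<dots> = exp (- (rate * (LINT x:{a<..b}|lborel. p x)) * (1 - s))"
      by (simp add: mult_ac)
    finally show "expectation (\<lambda>\<omega>. s ^ K \<omega>) = exp (- (rate * (LINT x:{a<..b}|lborel. p x)) * (1 - s))" .
  qed
qed

end

section \<open>The expected number of successful uploads\<close>

text \<open>Here \<open>w\<close> is the time between the later of arrival and round start and the upload deadline,
  \<open>\<theta>\<close> stands for \<open>T_min\<close>, and \<open>B\<close> for \<open>\<beta> * H\<close>.\<close>
definition success_prob :: "real \<Rightarrow> real \<Rightarrow> real \<Rightarrow> real" where
  "success_prob \<theta> B w = max 0 (1 - exp (- ((w - \<theta>) / B)))"

text \<open>An antiderivative is x + B exp(-(x - l)/B).\<close>

lemma has_integral_exp_rise:
  fixes B l u :: real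
  assumes "B > 0" "l \<le> u"
  shows "((\<lambda>x. 1 - exp (- ((x - l) / B))) has_integral (u - l) - B * (1 - exp (- ((u - l) / B)))) {l..u}"
proof -
  have "((\<lambda>x. 1 - exp (- ((x - l) / B))) has_integral
      (u + B * exp (- ((u - l) / B))) - (l + B * exp (- ((l - l) / B)))) {l..u}"
    using assms
    by (intro fundamental_theorem_of_calculus)
      (auto intro!: derivative_eq_intros simp flip: has_real_derivative_iff_has_vector_derivative)
  then show ?thesis by (simp add: algebra_simps)
qed

text \<open>An antiderivative is x - B exp(-(u - x)/B).\<close>

lemma has_integral_exp_fall:
  fixes B l u :: real
  assumes "B > 0" "l \<le> u"
  shows "((\<lambda>x. 1 - exp (- ((u - x) / B))) has_integral (u - l) - B * (1 - exp (- ((u - l) / B)))) {l..u}"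
proof -
  have "((\<lambda>x. 1 - exp (- ((u - x) / B))) has_integral
      (u - B * exp (- ((u - u) / B))) - (l - B * exp (- ((u - l) / B)))) {l..u}"
    using assms
    by (intro fundamental_theorem_of_calculus)
      (auto intro!: derivative_eq_intros simp flip: has_real_derivative_iff_has_vector_derivative)
  then show ?thesis by (simp add: algebra_simps)
qed

text \<open>The time available to a vehicle arriving at time \<open>x\<close> is a trapezoid in \<open>x\<close>: it rises
  with slope 1 up to \<open>min T T0\<close>, stays there for a time \<open>\<bar>T - T0\<bar>\<close>, and falls with slope -1.\<close>
lemma has_integral_success_prob:
  fixes B T T0 \<theta> c :: real
  assumes "B > 0" "\<theta> \<ge> 0" "\<theta> \<le> min T T0"
  defines "\<Xi> \<equiv> min T T0 - \<theta>"
  shows "((\<lambda>x. success_prob \<theta> B (min (x + T0) (c + T) - max c x)) has_integral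
    2 * \<Xi> + (1 - exp (- (\<Xi> / B))) * (\<bar>T - T0\<bar> - 2 * B)) {c - T0..c + T}"
    (is "(?f has_integral _) _")
proof -
  let ?m = "min T T0" and ?q = "1 - exp (- (\<Xi> / B))"
  have pos: "success_prob \<theta> B w = 1 - exp (- ((w - \<theta>) / B))" if "w \<ge> \<theta>" for w
    using that \<open>B > 0\<close> by (simp add: success_prob_def)
  have neg: "success_prob \<theta> B w = 0" if "w \<le> \<theta>" for w
    using that \<open>B > 0\<close> by (simp add: success_prob_def divide_le_0_iff)
  have 1: "(?f has_integral 0) {c - T0..c - T0 + \<theta>}"
    by (rule has_integral_is_0) (auto intro!: neg)
  have 2: "(?f has_integral \<Xi> - B * ?q) {c - T0 + \<theta>..c - T0 + ?m}"
  proof (rule has_integral_eq[rotated])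
    show "((\<lambda>x. 1 - exp (- ((x - (c - T0 + \<theta>)) / B))) has_integral \<Xi> - B * ?q) {c - T0 + \<theta>..c - T0 + ?m}"
      using has_integral_exp_rise[OF \<open>B > 0\<close>, of "c - T0 + \<theta>" "c - T0 + ?m"] assms(3)
      by (simp add: \<Xi>_def)
    fix x assume "x \<in> {c - T0 + \<theta>..c - T0 + ?m}"
    then have "min (x + T0) (c + T) - max c x = x + T0 - c" "x + T0 - c \<ge> \<theta>" by auto
    then show "1 - exp (- ((x - (c - T0 + \<theta>)) / B)) = ?f x" by (simp add: pos algebra_simps)
  qed
  \<comment> \<open>The plateau has length T + T0 - 2 min(T, T0) = |T - T0|.\<close>
  have 3: "(?f has_integral \<bar>T - T0\<bar> * ?q) {c - T0 + ?m..c + T - ?m}"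
  proof (rule has_integral_eq[rotated])
    show "((\<lambda>x. ?q) has_integral \<bar>T - T0\<bar> * ?q) {c - T0 + ?m..c + T - ?m}"
    proof -
      have "c + T - ?m - (c - T0 + ?m) = \<bar>T - T0\<bar>" by (auto simp: min_def)
      moreover have "c - T0 + ?m \<le> c + T - ?m" by (auto simp: min_def)
      ultimately show ?thesis
        using has_integral_const_real[of ?q "c - T0 + ?m" "c + T - ?m"]
        by (simp only: real_scaleR_def measure_lborel_Icc)
    qed
    fix x assume "x \<in> {c - T0 + ?m..c + T - ?m}"
    then have "min (x + T0) (c + T) - max c x = ?m" by auto
    then show "?q = ?f x" using assms(3) by (simp add: pos \<Xi>_def)
  qed
  have 4: "(?f has_integral \<Xi> - B * ?q) {c + T - ?m..c + T - \<theta>}"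
  proof (rule has_integral_eq[rotated])
    show "((\<lambda>x. 1 - exp (- ((c + T - \<theta> - x) / B))) has_integral \<Xi> - B * ?q) {c + T - ?m..c + T - \<theta>}"
      using has_integral_exp_fall[OF \<open>B > 0\<close>, of "c + T - ?m" "c + T - \<theta>"] assms(3)
      by (simp add: \<Xi>_def)
    fix x assume "x \<in> {c + T - ?m..c + T - \<theta>}"
    then have "min (x + T0) (c + T) - max c x = c + T - x" "c + T - x \<ge> \<theta>" by auto
    then show "1 - exp (- ((c + T - \<theta> - x) / B)) = ?f x" by (simp add: pos algebra_simps)
  qed
  have 5: "(?f has_integral 0) {c + T - \<theta>..c + T}"
    by (rule has_integral_is_0) (auto intro!: neg)
  have "(?f has_integral 0 + (\<Xi> - B * ?q) + \<bar>T - T0\<bar> * ?q + (\<Xi> - B * ?q) + 0) {c - T0..c + T}"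
    using assms(2,3)
    by (intro has_integral_combine[OF _ _ has_integral_combine[OF _ _ has_integral_combine[OF _ _
            has_integral_combine[OF _ _ 1 2] 3] 4] 5]) auto
  then show ?thesis by (simp add: algebra_simps)
qed

lemma continuous_on_success_prob:
  assumes "B \<noteq> 0" "continuous_on S w"
  shows "continuous_on S (\<lambda>x. success_prob \<theta> B (w x))"
  unfolding success_prob_def using assms by (intro continuous_intros) auto

text \<open>Point counts use half-open intervals while the integral is computed on a closed one; the
  two differ by a null set.\<close>

lemma set_lebesgue_integral_half_open_eqI:
  fixes f :: "real \<Rightarrow> real"
  assumes cont: "continuous_on {a..b} f" and "(f has_integral I) {a..b}"
  shows "(LINT x:{a<..b}|lborel. f x) = I"
proof -
  have int: "set_integrable lborel {a..b} f" using borel_integrable_atLeastAtMost'[OF cont] .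
  have "(LINT x:{a<..b}|lborel. f x) = (LINT x:{a..b}|lborel. f x)"
  proof (rule set_integral_cong_set)
    show "set_borel_measurable lborel {a..b} f"
      using int unfolding set_integrable_def set_borel_measurable_def by blast
    show "set_borel_measurable lborel {a<..b} f"
      using set_integrable_subset[OF int, of "{a<..b}"]
      unfolding set_integrable_def set_borel_measurable_def by force
    show "AE x in lborel. x \<in> {a..b} \<longleftrightarrow> x \<in> {a<..b}"
      using AE_lborel_singleton[of a] by eventually_elim auto
  qed
  also have "\<dots> = I" using set_borel_integral_eq_integral(2)[OF int] assms(2) by (simp add: integral_unique)
  finally show ?thesis .
qed

section \<open>Successful uploads as a thinning of the arrivals\<close>

theorem theorem1:
  fixes M :: "'w measure"
    and \<zeta> :: "'v::countable \<Rightarrow> 'w \<Rightarrow> real"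
    and \<tau>\<^sub>c\<^sub>p :: "nat \<Rightarrow> 'v \<Rightarrow> 'w \<Rightarrow> real"
    and rate \<alpha> \<beta> T L v \<tau>\<^sub>d\<^sub>o\<^sub>w\<^sub>n \<tau>\<^sub>u\<^sub>p T0 :: real
    and H k :: nat
  assumes "prob_space M"
    and "rate > 0" "\<alpha> > 0" "\<beta> > 0" "T > 0" "L > 0" "v > 0"
    and "\<tau>\<^sub>d\<^sub>o\<^sub>w\<^sub>n \<ge> 0" "\<tau>\<^sub>u\<^sub>p \<ge> 0" "H > 0"
    and T0: "T0 = L / v"
    and arrivals: "prob_space.homogeneous_poisson_process M rate \<zeta>"
    and delay_distribution: "\<And>j m t. measure M {\<omega> \<in> space M. \<tau>\<^sub>c\<^sub>p j m \<omega> \<le> t} =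
          (if t \<ge> \<alpha> * real H then 1 - exp (- (1 / (\<beta> * real H) * (t - \<alpha> * real H))) else 0)"
    and delays_indep: "\<And>j. prob_space.indep_vars M (\<lambda>_. borel) (\<tau>\<^sub>c\<^sub>p j) UNIV"
    and delays_indep_arrivals: "\<And>j. prob_space.indep_var M
          (Pi\<^sub>M UNIV (\<lambda>_. borel)) (\<lambda>\<omega> m. \<zeta> m \<omega>) (Pi\<^sub>M UNIV (\<lambda>_. borel)) (\<lambda>\<omega> m. \<tau>\<^sub>c\<^sub>p j m \<omega>)"
    and Xi_pos: "Xi \<alpha> \<tau>\<^sub>d\<^sub>o\<^sub>w\<^sub>n \<tau>\<^sub>u\<^sub>p T0 H T > 0"
  shows "M_suc T T0 \<tau>\<^sub>d\<^sub>o\<^sub>w\<^sub>n \<tau>\<^sub>u\<^sub>p \<zeta> \<tau>\<^sub>c\<^sub>p k \<in> measurable M (count_space UNIV) \<and>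
    distr M (count_space UNIV) (M_suc T T0 \<tau>\<^sub>d\<^sub>o\<^sub>w\<^sub>n \<tau>\<^sub>u\<^sub>p \<zeta> \<tau>\<^sub>c\<^sub>p k) =
      measure_pmf (poisson_pmf (Lambda rate \<alpha> \<beta> \<tau>\<^sub>d\<^sub>o\<^sub>w\<^sub>n \<tau>\<^sub>u\<^sub>p T0 H T))"
proof -
  interpret prob_space M by fact
  define c where "c = real k * T"
  define B where "B = \<beta> * real H"
  define \<theta> where "\<theta> = T_min \<alpha> \<tau>\<^sub>d\<^sub>o\<^sub>w\<^sub>n \<tau>\<^sub>u\<^sub>p H"
  define w where "w x = min (x + T0) (c + T) - max c x" for x
  define p where "p x = success_prob \<theta> B (w x)" for x
  \<comment> \<open>The constraint \<open>x < c + T\<close> lets the thinning lemma, which uses half-open intervals, be applied.\<close>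
  define A where "A = {(x, d). x < c + T \<and> max c x + \<tau>\<^sub>d\<^sub>o\<^sub>w\<^sub>n + d + \<tau>\<^sub>u\<^sub>p \<le> min (x + T0) (c + T)}"
  have "T0 > 0" using T0 \<open>L > 0\<close> \<open>v > 0\<close> by simp
  have "B > 0" using \<open>\<beta> > 0\<close> \<open>H > 0\<close> by (simp add: B_def)
  have "\<theta> > 0" using \<open>\<alpha> > 0\<close> \<open>H > 0\<close> \<open>\<tau>\<^sub>d\<^sub>o\<^sub>w\<^sub>n \<ge> 0\<close> \<open>\<tau>\<^sub>u\<^sub>p \<ge> 0\<close> by (simp add: \<theta>_def T_min_def add_pos_nonneg)
  have "\<theta> < min T T0" using Xi_pos by (simp add: Xi_def \<theta>_def)
  have A [measurable]: "A \<in> sets (borel \<Otimes>\<^sub>M borel)"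
  proof -
    have "{q \<in> space (borel \<Otimes>\<^sub>M borel). fst q < c + T \<and>
        max c (fst q) + \<tau>\<^sub>d\<^sub>o\<^sub>w\<^sub>n + snd q + \<tau>\<^sub>u\<^sub>p \<le> min (fst q + T0) (c + T)} \<in> sets (borel \<Otimes>\<^sub>M borel)"
      by measurable
    then show ?thesis by (simp add: A_def case_prod_beta' space_pair_measure)
  qed
  have p_eq: "prob {\<omega> \<in> space M. (x, \<tau>\<^sub>c\<^sub>p k m \<omega>) \<in> A} = p x" for m x
  proof (cases "x < c + T")
    case True
    then have "{\<omega> \<in> space M. (x, \<tau>\<^sub>c\<^sub>p k m \<omega>) \<in> A} =
        {\<omega> \<in> space M. \<tau>\<^sub>c\<^sub>p k m \<omega> \<le> w x - \<tau>\<^sub>d\<^sub>o\<^sub>w\<^sub>n - \<tau>\<^sub>u\<^sub>p}"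
      by (auto simp: A_def w_def)
    \<comment> \<open>The onset of the shifted exponential is exactly where the maximum in
      \<open>success_prob\<close> switches from 0 to its second argument.\<close>
    moreover have "\<alpha> * real H \<le> w x - \<tau>\<^sub>d\<^sub>o\<^sub>w\<^sub>n - \<tau>\<^sub>u\<^sub>p \<longleftrightarrow> (w x - \<theta>) / B \<ge> 0"
      using \<open>B > 0\<close> by (auto simp: \<theta>_def T_min_def zero_le_divide_iff)
    moreover have "1 / B * (w x - \<tau>\<^sub>d\<^sub>o\<^sub>w\<^sub>n - \<tau>\<^sub>u\<^sub>p - \<alpha> * real H) = (w x - \<theta>) / B"
      by (simp add: \<theta>_def T_min_def diff_diff_eq add_ac)
    ultimately show ?thesis
      unfolding p_def success_prob_def by (simp add: delay_distribution B_def)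
  next
    case False
    \<comment> \<open>From the end of the round on no time is available, so \<open>p\<close>
      vanishes there and agrees with the constraint built into \<open>A\<close>.\<close>
    then have "w x \<le> 0" by (auto simp: w_def)
    then have "p x = 0"
      using \<open>B > 0\<close> \<open>\<theta> > 0\<close> by (simp add: p_def success_prob_def divide_le_0_iff)
    with False show ?thesis by (simp add: A_def)
  qed
  have cont: "continuous_on {c - T0..c + T} p"
    unfolding p_def w_def using \<open>B > 0\<close> by (intro continuous_on_success_prob continuous_intros) auto
  have "(LINT x:{c - T0<..c + T}|lborel. p x) =
      2 * (min T T0 - \<theta>) + (1 - exp (- ((min T T0 - \<theta>) / B))) * (\<bar>T - T0\<bar> - 2 * B)" (is "?I = ?R")
    using has_integral_success_prob[OF \<open>B > 0\<close>, of \<theta> T T0 c] \<open>\<theta> > 0\<close> \<open>\<theta> < min T T0\<close>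
    by (intro set_lebesgue_integral_half_open_eqI cont) (simp add: p_def[abs_def] w_def)
  \<comment> \<open>The thinning result requires a positive integral. The factor |T - T0| - 2B may
    be negative, but 1 - exp(-y) < y for y > 0 keeps the loss 2B(1 - exp(-y)) below the first term
    2By.\<close>
  moreover have "?R > 0"
  proof -
    define y where "y = (min T T0 - \<theta>) / B"
    have "y > 0" and y: "min T T0 - \<theta> = B * y"
      using \<open>B > 0\<close> \<open>\<theta> < min T T0\<close> by (simp_all add: y_def)
    have "2 * B * (1 - exp (- y)) < 2 * B * y"
      using exp_minus_greater[of y] \<open>y > 0\<close> \<open>B > 0\<close> by simp
    moreover have "(1 - exp (- y)) * \<bar>T - T0\<bar> \<ge> 0" using \<open>y > 0\<close> by simp
    ultimately show ?thesis using \<open>B > 0\<close> by (simp add: y algebra_simps)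
  qed
  moreover have "rate * ?R = Lambda rate \<alpha> \<beta> \<tau>\<^sub>d\<^sub>o\<^sub>w\<^sub>n \<tau>\<^sub>u\<^sub>p T0 H T"
    by (simp add: Lambda_def Xi_def \<theta>_def B_def algebra_simps)
  moreover have "M_suc T T0 \<tau>\<^sub>d\<^sub>o\<^sub>w\<^sub>n \<tau>\<^sub>u\<^sub>p \<zeta> \<tau>\<^sub>c\<^sub>p k =
      (\<lambda>\<omega>. card {m. \<zeta> m \<omega> \<in> {c - T0<..c + T} \<and> (\<zeta> m \<omega>, \<tau>\<^sub>c\<^sub>p k m \<omega>) \<in> A})"
    unfolding M_suc_def[abs_def] successful_vehicles_def round_vehicles_def upload_completion_def
      upload_deadline_def A_def c_def
    by (intro ext arg_cong[where f = card]) (auto simp: algebra_simps)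
  moreover have "c - T0 < c + T" using \<open>T0 > 0\<close> \<open>T > 0\<close> by simp
  ultimately show ?thesis
    using poisson_process_thinning[OF arrivals \<open>rate > 0\<close> _ delays_indep[of k] delays_indep_arrivals[of k] A p_eq cont]
    by simp
qed

end
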